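(* For every prime power $q > 2$, Homma's constant satisfies $D(q) \ge 1$.
   Context: Let $q$ be a prime power and $\mathbb{F}_q$ the finite field with $q$ elements. For a positive integer $d$, let $M_q(d)$ denote the maximum of $|\mathcal{X}(\mathbb{F}_q)|$ (the number of $\mathbb{F}_q$-rational points) taken over all irreducible projective curves $\mathcal{X}$ of degree $d$ defined over $\mathbb{F}_q$ lying in a projective space $\mathbb{P}^n$ over $\mathbb{F}_q$ of any dimension $n$ (the dimension is not fixed; the curves need not be nonsingular). Homma's constant is $D(q) := \limsup_{d\to\infty} M_q(d)/d$. *)

theory Defs
  imports "HOL-Computational_Algebra.Polynomial" "HOL-Library.Extended_Real" "HOL-Library.Liminf_Limsup"
begin

text \<open>Points of projective n-space over an algebraically closed field K are represented by
  nonzero coordinate vectors v :: nat => K with v i = 0 for i > n (homogeneous coordinates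
  x_0..x_n). Homogeneous forms of degree m in x_0..x_n are coefficient functions on the
  finite set of exponent vectors of total degree m.\<close>

definition alg_closed_field :: "'k::field itself \<Rightarrow> bool" where
  "alg_closed_field _ \<longleftrightarrow> (\<forall>p::'k poly. degree p > 0 \<longrightarrow> (\<exists>x. poly p x = 0))"

definition subfield :: "'k::field set \<Rightarrow> bool" where
  "subfield F \<longleftrightarrow> 0 \<in> F \<and> 1 \<in> F \<and> (\<forall>x\<in>F. \<forall>y\<in>F. x + y \<in> F \<and> x * y \<in> F)
     \<and> (\<forall>x\<in>F. - x \<in> F \<and> inverse x \<in> F)"

definition coordvec :: "nat \<Rightarrow> (nat \<Rightarrow> 'k::field) \<Rightarrow> bool" where
  "coordvec n v \<longleftrightarrow> (\<forall>i>n. v i = 0)"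

definition monoms :: "nat \<Rightarrow> nat \<Rightarrow> (nat \<Rightarrow> nat) set" where
  "monoms n m = {\<alpha>. (\<forall>i>n. \<alpha> i = 0) \<and> (\<Sum>i\<le>n. \<alpha> i) = m}"

definition evalf :: "nat \<Rightarrow> nat \<Rightarrow> ((nat \<Rightarrow> nat) \<Rightarrow> 'k::field) \<Rightarrow> (nat \<Rightarrow> 'k) \<Rightarrow> 'k" where
  "evalf n m c v = (\<Sum>\<alpha>\<in>monoms n m. c \<alpha> * (\<Prod>i\<le>n. v i ^ \<alpha> i))"

definition zset :: "nat \<Rightarrow> (nat \<times> ((nat \<Rightarrow> nat) \<Rightarrow> 'k::field)) set \<Rightarrow> (nat \<Rightarrow> 'k) set" where
  "zset n S = {v. coordvec n v \<and> v \<noteq> (\<lambda>_. 0) \<and> (\<forall>(m, c)\<in>S. evalf n m c v = 0)}"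

definition closed_over :: "nat \<Rightarrow> 'k::field set \<Rightarrow> (nat \<Rightarrow> 'k) set \<Rightarrow> bool" where
  "closed_over n R A \<longleftrightarrow> (\<exists>S. (\<forall>(m, c)\<in>S. \<forall>\<alpha>\<in>monoms n m. c \<alpha> \<in> R) \<and> A = zset n S)"

text \<open>Irreducible over the algebraically closed field K (geometric irreducibility).\<close>
definition irreducible_closed :: "nat \<Rightarrow> (nat \<Rightarrow> 'k::field) set \<Rightarrow> bool" where
  "irreducible_closed n X \<longleftrightarrow> X \<noteq> {} \<and>
     (\<forall>A B. closed_over n UNIV A \<longrightarrow> closed_over n UNIV B \<longrightarrow> X \<subseteq> A \<union> B \<longrightarrow> X \<subseteq> A \<or> X \<subseteq> B)"

text \<open>Hilbert function: dimension over K of the space of degree-m forms restricted to X,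
  i.e. of the degree-m part of the homogeneous coordinate ring of X.\<close>
definition hilb :: "nat \<Rightarrow> (nat \<Rightarrow> 'k::field) set \<Rightarrow> nat \<Rightarrow> nat" where
  "hilb n X m = Sup {k. \<exists>fs :: nat \<Rightarrow> (nat \<Rightarrow> nat) \<Rightarrow> 'k.
      \<forall>a :: nat \<Rightarrow> 'k. (\<forall>v\<in>X. (\<Sum>j<k. a j * evalf n m (fs j) v) = 0) \<longrightarrow> (\<forall>j<k. a j = 0)}"

text \<open>X is an irreducible projective curve in P^n defined over F, of degree d
  (degree = leading coefficient of the Hilbert polynomial, which has degree 1 for curves).\<close>
definition curve_of_degree :: "'k::field set \<Rightarrow> nat \<Rightarrow> (nat \<Rightarrow> 'k) set \<Rightarrow> nat \<Rightarrow> bool" where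
  "curve_of_degree F n X d \<longleftrightarrow> closed_over n F X \<and> irreducible_closed n X \<and> d > 0 \<and>
     ((\<lambda>m. real (hilb n X m) / real m) \<longlonglongrightarrow> real d)"

definition pclass :: "(nat \<Rightarrow> 'k::field) \<Rightarrow> (nat \<Rightarrow> 'k) set" where
  "pclass v = {w. \<exists>c. c \<noteq> 0 \<and> w = (\<lambda>i. c * v i)}"

definition rat_points :: "'k::field set \<Rightarrow> (nat \<Rightarrow> 'k) set \<Rightarrow> (nat \<Rightarrow> 'k) set set" where
  "rat_points F X = {pclass v | v. v \<in> X \<and> (\<forall>i. v i \<in> F)}"

definition Mq :: "'k::field set \<Rightarrow> nat \<Rightarrow> ereal" where
  "Mq F d = Sup {ereal (real (card (rat_points F X))) | n X. curve_of_degree F n X d}"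

definition homma_D :: "'k::field set \<Rightarrow> ereal" where
  "homma_D F = limsup (\<lambda>d. Mq F d / ereal (real d))"

end

theory Submission
  imports Defs "HOL-Library.FuncSet"
begin

text \<open>Let \<open>P(T)\<close> be the product of \<open>T - a\<close> over all \<open>a \<in> F\<close> and consider the Artin-Schreier tower
  \<open>P(y\<^sub>1) = x\<close>, \<open>P(y\<^sub>i) = x y\<^sub>i\<^sub>-\<^sub>1\<close> for \<open>2 \<le> i \<le> k\<close>. Over \<open>x = 0\<close> every level splits completely, which gives
  \<open>q\<^sup>k\<close> rational points, while the homogenized equations \<open>P(y\<^sub>i, z) = z\<^sup>q\<^sup>-\<^sup>2 x y\<^sub>i\<^sub>-\<^sub>1\<close> define a curve of degree
  only \<open>q\<^sup>k\<close>: the monomials whose exponents in the \<open>y\<^sub>i\<close> are below \<open>q\<close> form a basis of the coordinate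
  ring. Infinity is totally ramified in the tower, so the pole orders there give these monomials
  pairwise distinct weights; leading terms therefore multiply without cancellation, and the
  coordinate ring is a domain.\<close>

section \<open>Homogeneous linear systems\<close>

lemma homogeneous_system_nontrivial_solution:
  fixes M :: "'j \<Rightarrow> 'b \<Rightarrow> 'k::field"
  assumes "finite B" "finite J" "card B < card J"
  shows "\<exists>a. (\<forall>b\<in>B. (\<Sum>j\<in>J. a j * M j b) = 0) \<and> (\<exists>j\<in>J. a j \<noteq> 0)"
  using assms
proof (induction B arbitrary: J M rule: finite_induct)
  case empty
  then have "J \<noteq> {}" by auto
  then show ?case by (intro exI[of _ "\<lambda>_. 1"]) auto
next
  case (insert b B)
  show ?case
  proof (cases "\<forall>j\<in>J. M j b = 0")
    case True
    have "card B < card J" using insert by simp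
    from insert.IH[OF insert.prems(1) this, of M] obtain a where
      "\<forall>b\<in>B. (\<Sum>j\<in>J. a j * M j b) = 0" "\<exists>j\<in>J. a j \<noteq> 0" by blast
    then show ?thesis using True by (intro exI[of _ a]) auto
  next
    case False
    then obtain i where i: "i \<in> J" "M i b \<noteq> 0" by blast
    define J' where "J' = J - {i}"
    have J: "J = insert i J'" "i \<notin> J'" "finite J'" using i insert.prems by (auto simp: J'_def)
    \<comment> \<open>Equation \<open>b\<close> is solved for the unknown \<open>i\<close>.
      \<open>M'\<close> holds the coefficients of the other equations after the substitution, and
      \<open>s\<close> below is the value that the substitution assigns to the unknown
      \<open>i\<close>.\<close>
    define M' where "M' = (\<lambda>j c. M j c - M j b / M i b * M i c)"
    have "card B < card J'" using insert J by simp
    from insert.IH[OF J(3) this, of M'] obtain a where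
      a: "\<forall>c\<in>B. (\<Sum>j\<in>J'. a j * M' j c) = 0" "\<exists>j\<in>J'. a j \<noteq> 0" by blast
    define s where "s = - (\<Sum>j\<in>J'. a j * M j b) / M i b"
    define a' where "a' = a(i := s)"
    have a': "(\<Sum>j\<in>J. a' j * M j c) = s * M i c + (\<Sum>j\<in>J'. a j * M j c)" for c
    proof -
      have "(\<Sum>j\<in>J'. a' j * M j c) = (\<Sum>j\<in>J'. a j * M j c)"
        using J by (intro sum.cong) (auto simp: a'_def)
      then show ?thesis using J by (simp add: a'_def)
    qed
    have "(\<Sum>j\<in>J. a' j * M j b) = 0" using i by (simp add: a' s_def)
    moreover have "(\<Sum>j\<in>J. a' j * M j c) = 0" if "c \<in> B" for c
    proof -
      have "0 = (\<Sum>j\<in>J'. a j * M' j c)" using a that by simp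
      also have "\<dots> = (\<Sum>j\<in>J'. a j * M j c) - (\<Sum>j\<in>J'. a j * M j b) * M i c / M i b"
        by (simp add: M'_def algebra_simps sum_subtractf sum_distrib_left sum_distrib_right sum_divide_distrib)
      finally show ?thesis by (simp add: a' s_def)
    qed
    moreover have "\<exists>j\<in>J. a' j \<noteq> 0" using a J by (auto simp: a'_def)
    ultimately show ?thesis by (intro exI[of _ a']) auto
  qed
qed

section \<open>Monomials, forms and the Hilbert function\<close>

lemma finite_monoms: "finite (monoms n m)"
proof (rule finite_subset)
  show "monoms n m \<subseteq> {f. \<forall>i. (i \<in> {..n} \<longrightarrow> f i \<in> {..m}) \<and> (i \<notin> {..n} \<longrightarrow> f i = 0)}"
  proof
    fix \<alpha> assume \<alpha>: "\<alpha> \<in> monoms n m"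
    have "\<alpha> i \<le> m" if "i \<le> n" for i
      using \<alpha> that member_le_sum[of i "{..n}" \<alpha>] by (auto simp: monoms_def)
    moreover have "\<alpha> i = 0" if "\<not> i \<le> n" for i using \<alpha> that by (auto simp: monoms_def)
    ultimately show "\<alpha> \<in> {f. \<forall>i. (i \<in> {..n} \<longrightarrow> f i \<in> {..m}) \<and> (i \<notin> {..n} \<longrightarrow> f i = 0)}"
      by simp
  qed
  show "finite {f::nat \<Rightarrow> nat. \<forall>i. (i \<in> {..n} \<longrightarrow> f i \<in> {..m}) \<and> (i \<notin> {..n} \<longrightarrow> f i = 0)}"
    by (rule finite_set_of_finite_funs) auto
qed

definition mon :: "nat \<Rightarrow> (nat \<Rightarrow> nat) \<Rightarrow> (nat \<Rightarrow> 'k::field) \<Rightarrow> 'k" where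
  "mon n \<alpha> v = (\<Prod>i\<le>n. v i ^ \<alpha> i)"

lemma evalf_mon: "evalf n m c v = (\<Sum>\<alpha>\<in>monoms n m. c \<alpha> * mon n \<alpha> v)"
  by (simp add: evalf_def mon_def)

definition single :: "nat \<Rightarrow> nat \<Rightarrow> nat \<Rightarrow> nat" where
  "single i t = (\<lambda>l. if l = i then t else 0)"

lemma mon_add: "mon n (\<lambda>l. \<alpha> l + \<beta> l) v = mon n \<alpha> v * mon n \<beta> v"
  by (simp add: mon_def power_add prod.distrib)

lemma mon_single:
  assumes "i \<le> n" shows "mon n (single i t) v = v i ^ t"
proof -
  have "mon n (single i t) v = (\<Prod>l\<le>n. if l = i then v i ^ t else 1)"
    unfolding mon_def by (intro prod.cong) (auto simp: single_def)
  then show ?thesis using assms by simp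
qed

lemma monoms_add: "\<alpha> \<in> monoms n a \<Longrightarrow> \<beta> \<in> monoms n b \<Longrightarrow> (\<lambda>l. \<alpha> l + \<beta> l) \<in> monoms n (a + b)"
  by (auto simp: monoms_def sum.distrib)

lemma monoms_single: "i \<le> n \<Longrightarrow> single i t \<in> monoms n t"
  by (auto simp: monoms_def single_def)

text \<open>Forms are treated here as functions of the coordinate vector, so that equations can be
  assembled from pointwise sums and differences without touching coefficient functions.\<close>

definition form_over :: "'k::field set \<Rightarrow> nat \<Rightarrow> nat \<Rightarrow> ((nat \<Rightarrow> 'k) \<Rightarrow> 'k) \<Rightarrow> bool" where
  "form_over R n m f \<longleftrightarrow> (\<exists>c. (\<forall>\<alpha>\<in>monoms n m. c \<alpha> \<in> R) \<and> f = evalf n m c)"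

lemma form_over_mon:
  assumes "\<alpha> \<in> monoms n m" "r \<in> R" "0 \<in> R"
  shows "form_over R n m (\<lambda>v. r * mon n \<alpha> v)"
proof -
  have "evalf n m (\<lambda>\<beta>. if \<beta> = \<alpha> then r else 0) v = r * mon n \<alpha> v" for v
  proof -
    have "evalf n m (\<lambda>\<beta>. if \<beta> = \<alpha> then r else 0) v
        = (\<Sum>\<beta>\<in>monoms n m. if \<beta> = \<alpha> then r * mon n \<alpha> v else 0)"
      unfolding evalf_mon by (intro sum.cong) auto
    then show ?thesis using assms finite_monoms[of n m] by simp
  qed
  then show ?thesis using assms unfolding form_over_def
    by (intro exI[of _ "\<lambda>\<beta>. if \<beta> = \<alpha> then r else 0"]) auto
qed

lemma form_over_diff:
  assumes "form_over R n m f" "form_over R n m g" "subfield R"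
  shows "form_over R n m (\<lambda>v. f v - g v)"
proof -
  obtain c d where c: "\<forall>\<alpha>\<in>monoms n m. c \<alpha> \<in> R" "f = evalf n m c"
    and d: "\<forall>\<alpha>\<in>monoms n m. d \<alpha> \<in> R" "g = evalf n m d"
    using assms by (auto simp: form_over_def)
  have "c \<alpha> - d \<alpha> \<in> R" if "\<alpha> \<in> monoms n m" for \<alpha>
    using c d that assms(3) unfolding subfield_def by (metis add_uminus_conv_diff)
  then show ?thesis using c d unfolding form_over_def
    by (intro exI[of _ "\<lambda>\<alpha>. c \<alpha> - d \<alpha>"]) (auto simp: evalf_mon sum_subtractf algebra_simps)
qed

lemma form_over_sum:
  assumes "finite I" "\<And>i. i \<in> I \<Longrightarrow> form_over R n m (f i)" "subfield R"
  shows "form_over R n m (\<lambda>v. \<Sum>i\<in>I. f i v)"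
  using assms(1,2)
proof (induction I rule: finite_induct)
  case empty
  then show ?case using assms(3) unfolding form_over_def subfield_def
    by (intro exI[of _ "\<lambda>_. 0"]) (auto simp: evalf_mon)
next
  case (insert i I)
  obtain c d where c: "\<forall>\<alpha>\<in>monoms n m. c \<alpha> \<in> R" "f i = evalf n m c"
    and d: "\<forall>\<alpha>\<in>monoms n m. d \<alpha> \<in> R" "(\<lambda>v. \<Sum>i\<in>I. f i v) = evalf n m d"
    using insert.IH insert.prems unfolding form_over_def by (metis insertI1 insertI2)
  have "f i v + (\<Sum>i\<in>I. f i v) = evalf n m (\<lambda>\<alpha>. c \<alpha> + d \<alpha>) v" for v
    using c(2) fun_cong[OF d(2), of v] by (simp add: evalf_mon sum.distrib algebra_simps)
  moreover have "\<forall>\<alpha>\<in>monoms n m. c \<alpha> + d \<alpha> \<in> R" using c(1) d(1) assms(3) by (auto simp: subfield_def)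
  ultimately show ?case using insert.hyps unfolding form_over_def
    by (intro exI[of _ "\<lambda>\<alpha>. c \<alpha> + d \<alpha>"]) auto
qed

text \<open>The family \<open>B\<close> itself attains the supremum in \<open>hilb\<close>, by
  independence. A family of more than \<open>card B\<close> forms has coordinate vectors over
  \<open>B\<close> that satisfy a nontrivial linear relation, and this relation persists on
  \<open>X\<close>.\<close>

lemma hilb_eq_card:
  assumes B: "B \<subseteq> monoms n m"
    and spanning: "\<And>f. \<exists>c. \<forall>v\<in>X. evalf n m f v = (\<Sum>\<gamma>\<in>B. c \<gamma> * mon n \<gamma> v)"
    and indep: "\<And>c. (\<forall>v\<in>X. (\<Sum>\<gamma>\<in>B. c \<gamma> * mon n \<gamma> v) = 0) \<Longrightarrow> \<forall>\<gamma>\<in>B. c \<gamma> = (0::'k::field)"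
  shows "hilb n X m = card B"
proof -
  have fB: "finite B" using B finite_monoms finite_subset by blast
  show ?thesis unfolding hilb_def
  proof (rule cSup_eq_maximum, safe)
    obtain h where h: "bij_betw h {..<card B} B"
      using ex_bij_betw_nat_finite[OF fB] by (auto simp: atLeast0LessThan)
    define fs where "fs = (\<lambda>j \<alpha>. if \<alpha> = h j then 1 else 0 :: 'k)"
    have fs: "evalf n m (fs j) v = mon n (h j) v" if "j < card B" for j v
    proof -
      have "evalf n m (fs j) v = (\<Sum>\<alpha>\<in>monoms n m. if \<alpha> = h j then mon n (h j) v else 0)"
        unfolding evalf_mon fs_def by (intro sum.cong) auto
      moreover have "h j \<in> monoms n m" using h that B by (auto simp: bij_betw_def)
      ultimately show ?thesis using finite_monoms[of n m] by simp
    qed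
    have "\<forall>j<card B. a j = 0"
      if a: "\<forall>v\<in>X. (\<Sum>j<card B. a j * evalf n m (fs j) v) = 0" for a
    proof -
      define h' where "h' = inv_into {..<card B} h"
      have h': "h' (h j) = j" if "j < card B" for j
        using h that by (auto simp: h'_def bij_betw_def)
      have "(\<Sum>\<gamma>\<in>B. a (h' \<gamma>) * mon n \<gamma> v) = 0" if "v \<in> X" for v
      proof -
        have "(\<Sum>\<gamma>\<in>B. a (h' \<gamma>) * mon n \<gamma> v) = (\<Sum>j<card B. a (h' (h j)) * mon n (h j) v)"
          using sum.reindex_bij_betw[OF h, of "\<lambda>\<gamma>. a (h' \<gamma>) * mon n \<gamma> v"] by simp
        also have "\<dots> = (\<Sum>j<card B. a j * evalf n m (fs j) v)"
          by (intro sum.cong) (auto simp: h' fs)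
        finally show ?thesis using a that by simp
      qed
      then have "\<forall>\<gamma>\<in>B. a (h' \<gamma>) = 0" by (intro indep) auto
      then show ?thesis using h h' by (metis bij_betwE lessThan_iff)
    qed
    then show "\<exists>fs :: nat \<Rightarrow> (nat \<Rightarrow> nat) \<Rightarrow> 'k.
      \<forall>a. (\<forall>v\<in>X. (\<Sum>j<card B. a j * evalf n m (fs j) v) = 0) \<longrightarrow> (\<forall>j<card B. a j = 0)" by blast
  next
    fix k :: nat and fs :: "nat \<Rightarrow> (nat \<Rightarrow> nat) \<Rightarrow> 'k"
    assume fs: "\<forall>a. (\<forall>v\<in>X. (\<Sum>j<k. a j * evalf n m (fs j) v) = 0) \<longrightarrow> (\<forall>j<k. a j = 0)"
    have "\<forall>j. \<exists>c. \<forall>v\<in>X. evalf n m (fs j) v = (\<Sum>\<gamma>\<in>B. c \<gamma> * mon n \<gamma> v)" using spanning by blast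
    then obtain M where M: "\<And>j v. v \<in> X \<Longrightarrow> evalf n m (fs j) v = (\<Sum>\<gamma>\<in>B. M j \<gamma> * mon n \<gamma> v)"
      by metis
    show "k \<le> card B"
    proof (rule ccontr)
      assume "\<not> k \<le> card B"
      then obtain a where a: "\<forall>b\<in>B. (\<Sum>j<k. a j * M j b) = 0" "\<exists>j<k. a j \<noteq> 0"
        using homogeneous_system_nontrivial_solution[OF fB, of "{..<k}" M] by auto
      have "(\<Sum>j<k. a j * evalf n m (fs j) v) = 0" if "v \<in> X" for v
      proof -
        have "(\<Sum>j<k. a j * evalf n m (fs j) v) = (\<Sum>j<k. \<Sum>\<gamma>\<in>B. a j * M j \<gamma> * mon n \<gamma> v)"
          using that by (simp add: M sum_distrib_left mult.assoc)
        also have "\<dots> = (\<Sum>\<gamma>\<in>B. (\<Sum>j<k. a j * M j \<gamma>) * mon n \<gamma> v)"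
          by (subst sum.swap) (simp add: sum_distrib_right)
        finally have "(\<Sum>j<k. a j * evalf n m (fs j) v) = (\<Sum>\<gamma>\<in>B. (\<Sum>j<k. a j * M j \<gamma>) * mon n \<gamma> v)" .
        then show ?thesis using a by simp
      qed
      then show False using fs a by blast
    qed
  qed
qed

section \<open>Polynomials in one variable and products of linear forms\<close>

lemma prod_linear_homogeneous_expansion:
  fixes A :: "'k::field set"
  assumes R: "subfield R" and "finite A" "A \<subseteq> R"
  shows "\<exists>p. p (card A) = 1 \<and> (\<forall>j. p j \<in> R) \<and>
    (\<forall>y z. (\<Prod>a\<in>A. y - a * z) = (\<Sum>j\<le>card A. p j * (y ^ j * z ^ (card A - j))))"
  using assms(2,3)
proof (induction A rule: finite_induct)
  case empty
  show ?case using R by (intro exI[of _ "\<lambda>_. 1"]) (auto simp: subfield_def)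
next
  case (insert a A)
  define N where "N = card A"
  obtain p where p: "p N = 1" "\<forall>j. p j \<in> R"
    "\<And>y z. (\<Prod>a\<in>A. y - a * z) = (\<Sum>j\<le>N. p j * (y ^ j * z ^ (N - j)))"
    using insert.IH insert.prems unfolding N_def by auto
  \<comment> \<open>Multiplying by \<open>y - a * z\<close> shifts the coefficients by one and
    subtracts \<open>a\<close> times the old ones. The cut-off at \<open>N\<close> is needed because
    the values of \<open>p\<close> beyond \<open>N\<close> are arbitrary elements of
    \<open>R\<close>.\<close>
  define p' where
    "p' = (\<lambda>j. (case j of 0 \<Rightarrow> 0 | Suc i \<Rightarrow> p i) - (if j \<le> N then a * p j else 0))"
  have "(\<Prod>a\<in>insert a A. y - a * z) = (\<Sum>j\<le>Suc N. p' j * (y ^ j * z ^ (Suc N - j)))" for y z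
  proof -
    have "(\<Prod>a\<in>insert a A. y - a * z) = (y - a * z) * (\<Sum>j\<le>N. p j * (y ^ j * z ^ (N - j)))"
      using insert.hyps p by simp
    also have "\<dots> = (\<Sum>j\<le>N. p j * (y ^ Suc j * z ^ (N - j)))
        - (\<Sum>j\<le>N. a * p j * (y ^ j * z ^ (Suc N - j)))"
      by (simp add: left_diff_distrib sum_distrib_left sum_subtractf Suc_diff_le algebra_simps)
    also have "(\<Sum>j\<le>N. p j * (y ^ Suc j * z ^ (N - j)))
       = (\<Sum>j\<le>Suc N. (case j of 0 \<Rightarrow> 0 | Suc i \<Rightarrow> p i) * (y ^ j * z ^ (Suc N - j)))"
      by (subst sum.atMost_Suc_shift) simp
    also have "(\<Sum>j\<le>N. a * p j * (y ^ j * z ^ (Suc N - j)))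
       = (\<Sum>j\<le>Suc N. (if j \<le> N then a * p j else 0) * (y ^ j * z ^ (Suc N - j)))"
      by simp
    finally show ?thesis by (simp only: p'_def sum_subtractf left_diff_distrib)
  qed
  moreover have "p' (Suc N) = 1" using p by (simp add: p'_def)
  moreover have "p' j \<in> R" for j
  proof -
    have "x - y \<in> R" if "x \<in> R" "y \<in> R" for x y
      using R that unfolding subfield_def by (metis add_uminus_conv_diff)
    then show ?thesis using R p insert.prems
      by (auto simp: p'_def subfield_def split: nat.split)
  qed
  ultimately show ?case using insert.hyps by (intro exI[of _ p']) (auto simp: N_def)
qed

text \<open>Over a finite field, 1 plus the product of all \<open>T - a\<close> takes only the value
  1 and so has no root.\<close>

lemma alg_closed_field_infinite:
  assumes "alg_closed_field TYPE('k::field)"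
  shows "infinite (UNIV :: 'k set)"
proof
  assume fin: "finite (UNIV :: 'k set)"
  define p where "p = (\<Prod>a\<in>(UNIV :: 'k set). [:-a, 1:])"
  have d: "degree p = card (UNIV :: 'k set)" unfolding p_def
    by (subst degree_prod_eq_sum_degree) auto
  have "degree (p + 1) = degree p" using d fin by (intro degree_add_eq_left) (simp add: finite_UNIV_card_ge_0)
  then have "degree (p + 1) > 0" using d fin by (simp add: finite_UNIV_card_ge_0)
  then obtain x where "poly (p + 1) x = 0" using assms unfolding alg_closed_field_def by blast
  moreover have "poly p x = 0" unfolding p_def poly_prod using fin by (auto intro!: prod_zero)
  ultimately show False by simp
qed

text \<open>A nonzero polynomial of degree below \<open>N\<close> has fewer than \<open>N\<close>
  roots. The two alternatives for \<open>Y\<close> serve the base of the tower, where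
  \<open>Y\<close> is the whole field, and the fibres of its levels, which have \<open>q\<close>
  known points.\<close>

lemma poly_sum_zero_imp_coeffs_zero:
  fixes c :: "nat \<Rightarrow> 'k::field"
  assumes "\<And>y. y \<in> Y \<Longrightarrow> (\<Sum>e<N. c e * y ^ e) = 0" "infinite Y \<or> N \<le> card Y"
  shows "\<forall>e<N. c e = 0"
proof -
  define p where "p = (\<Sum>e<N. monom (c e) e)"
  have co: "coeff p e = (if e < N then c e else 0)" for e
    by (simp add: p_def coeff_sum)
  have "p = 0"
  proof (rule ccontr)
    assume nz: "p \<noteq> 0"
    have sub: "Y \<subseteq> {y. poly p y = 0}" using assms(1) by (auto simp: p_def poly_sum poly_monom)
    have fin: "finite {y. poly p y = 0}" using nz by (rule poly_roots_finite)
    have "card Y \<le> card {y. poly p y = 0}" using sub fin by (rule card_mono[rotated])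
    also have "\<dots> \<le> degree p" using nz by (rule card_poly_roots_bound)
    also have "\<dots> < N" using co nz by (metis leading_coeff_0_iff)
    finally show False using assms(2) finite_subset[OF sub fin] by auto
  qed
  then show ?thesis using co by (metis coeff_0)
qed


section \<open>Pole orders at infinity as weights of exponent vectors\<close>

lemma monoms_eqI:
  assumes "\<alpha> \<in> monoms n m" "\<beta> \<in> monoms n m" "1 \<le> n" "\<And>i. i \<le> n \<Longrightarrow> i \<noteq> 1 \<Longrightarrow> \<alpha> i = \<beta> i"
  shows "\<alpha> = \<beta>"
proof
  fix i
  have "sum \<alpha> ({..n} - {1}) = sum \<beta> ({..n} - {1})" using assms(4) by (intro sum.cong) auto
  moreover have "sum \<alpha> {..n} = \<alpha> 1 + sum \<alpha> ({..n} - {1})" "sum \<beta> {..n} = \<beta> 1 + sum \<beta> ({..n} - {1})"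
    using assms(3) by (auto intro!: sum.remove)
  ultimately have "\<alpha> 1 = \<beta> 1" using assms(1,2) by (simp add: monoms_def)
  then show "\<alpha> i = \<beta> i" using assms by (cases "i \<le> n"; cases "i = 1") (auto simp: monoms_def)
qed

text \<open>The pole order at infinity of the monomial with exponents \<open>\<alpha>\<close> on level \<open>j\<close> of the tower, where \<open>x\<close> has
  pole order \<open>q\<^sup>j\<close>. Passing to the next level multiplies all pole orders by the ramification index \<open>q\<close>.\<close>
primrec wt :: "nat \<Rightarrow> nat \<Rightarrow> (nat \<Rightarrow> nat) \<Rightarrow> nat" where
  "wt q 0 \<alpha> = \<alpha> 0"
| "wt q (Suc j) \<alpha> = q * wt q j \<alpha> + (\<Sum>l<Suc j. q ^ l) * \<alpha> (Suc (Suc j))"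

lemma wt_add: "wt q j (\<lambda>l. \<alpha> l + \<beta> l) = wt q j \<alpha> + wt q j \<beta>"
  by (induction j) (simp_all add: algebra_simps del: sum.lessThan_Suc)

lemma wt_single_scale: "wt q j (single i t) = t * wt q j (single i 1)"
  by (induction j) (simp_all add: single_def algebra_simps del: sum.lessThan_Suc)

lemma wt_single_beyond: "i > Suc j \<Longrightarrow> wt q j (single i t) = 0"
  by (induction j) (simp_all add: single_def)

lemma wt_single_1: "wt q j (single 1 t) = 0"
  by (induction j) (simp_all add: single_def)

lemma wt_single_0: "wt q j (single 0 1) = q ^ j"
  by (induction j) (simp_all add: single_def)

lemma wt_single_last: "wt q j (single (Suc j) 1) = (\<Sum>l<j. q ^ l)"
proof (cases j)
  case (Suc i)
  then show ?thesis using wt_single_beyond[of i "Suc j" q 1] by (simp add: single_def)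
qed (simp add: single_def)

lemma geometric_Suc: "(\<Sum>l<Suc j. q ^ l) = 1 + q * (\<Sum>l<j. q ^ l)" for q :: nat
  unfolding sum.lessThan_Suc_shift by (simp add: sum_distrib_left)

text \<open>In the equation \<open>P(y_i) = x y_(i-1)\<close> the leading term \<open>y_i^q\<close>
  and the right-hand side have equal pole order. Hence rewriting \<open>y_i^q\<close> by the
  equation keeps the weight of the leading term. For \<open>i = 2\<close> the last summand belongs
  to \<open>z\<close> and is zero.\<close>

lemma wt_single_recurrence:
  assumes "2 \<le> i" "i \<le> Suc j"
  shows "q * wt q j (single i 1) = wt q j (single 0 1) + wt q j (single (i - 1) 1)"
  using assms
proof (induction j)
  case (Suc j)
  show ?case
  proof (cases "i \<le> Suc j")
    case True
    then have "q * wt q (Suc j) (single i 1) = q * (q * wt q j (single i 1))"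
      by (simp add: single_def)
    also have "\<dots> = q * (wt q j (single 0 1) + wt q j (single (i - 1) 1))" using Suc True by simp
    also have "\<dots> = wt q (Suc j) (single 0 1) + wt q (Suc j) (single (i - 1) 1)"
      using True Suc.prems by (simp add: single_def algebra_simps)
    finally show ?thesis .
  next
    case False
    then have i: "i = Suc (Suc j)" using Suc.prems by simp
    have "wt q (Suc j) (single (Suc j) 1) = q * (\<Sum>l<j. q ^ l)"
      using wt_single_last[of q j] by (simp add: single_def)
    then show ?thesis using wt_single_last[of q "Suc j"]
      by (simp add: i wt_single_0 distrib_left del: wt.simps One_nat_def)
  qed
qed simp

text \<open>Positivity ensures that the lower terms of \<open>P\<close> have strictly smaller weight
  than \<open>y_i^q\<close>.\<close>

lemma wt_single_pos:
  assumes "2 \<le> i" "i \<le> Suc j" "q > 0" shows "wt q j (single i 1) > 0"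
proof -
  have "q * wt q j (single i 1) > 0"
    using wt_single_recurrence[OF assms(1,2), of q] assms(3) by (simp add: wt_single_0 del: One_nat_def)
  then show ?thesis by simp
qed

text \<open>Modulo q, the weight of level j + 1 is the exponent of the last variable; this recovers
  the exponents one after the other.\<close>
lemma wt_inject:
  assumes "wt q j \<alpha> = wt q j \<beta>" "\<And>i. 2 \<le> i \<Longrightarrow> i \<le> Suc j \<Longrightarrow> \<alpha> i < q \<and> \<beta> i < q"
    and "i \<le> Suc j" "i \<noteq> 1"
  shows "\<alpha> i = \<beta> i"
  using assms
proof (induction j arbitrary: i)
  case (Suc j)
  have m: "wt q (Suc j) \<gamma> mod q = \<gamma> (Suc (Suc j)) mod q" for \<gamma>
  proof -
    have "wt q (Suc j) \<gamma> = \<gamma> (Suc (Suc j)) + q * (wt q j \<gamma> + (\<Sum>l<j. q ^ l) * \<gamma> (Suc (Suc j)))"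
      unfolding wt.simps geometric_Suc by (simp add: algebra_simps)
    then show ?thesis by (metis mod_mult_self2)
  qed
  have lt: "\<alpha> (Suc (Suc j)) < q" "\<beta> (Suc (Suc j)) < q" using Suc.prems(2)[of "Suc (Suc j)"] by auto
  have last: "\<alpha> (Suc (Suc j)) = \<beta> (Suc (Suc j))" using m[of \<alpha>] m[of \<beta>] lt Suc.prems(1) by (metis mod_less)
  then have "wt q j \<alpha> = wt q j \<beta>" using Suc.prems(1) lt by (simp del: sum.lessThan_Suc)
  then show ?case using Suc.IH[of i] Suc.prems last by (cases "i = Suc (Suc j)") auto
qed (auto simp: le_Suc_eq)

text \<open>The coordinate \<open>v 0\<close> is the base coordinate \<open>x\<close>, \<open>v 1\<close> is the homogenizing coordinate \<open>z\<close>,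
  which also serves as the bottom \<open>y\<^sub>0\<close> of the tower, and \<open>v (i + 1)\<close> is \<open>y\<^sub>i\<close>.\<close>
locale artin_schreier_tower =
  fixes F :: "'k::field set" and k :: nat
  assumes alg_closed: "alg_closed_field TYPE('k)"
    and subfield: "subfield F" and finite_F: "finite F" and card_F: "2 \<le> card F"
begin

section \<open>The curve and its equations over \<open>F\<close>\<close>

abbreviation q :: nat where "q \<equiv> card F"
abbreviation n :: nat where "n \<equiv> Suc k"
abbreviation weight :: "(nat \<Rightarrow> nat) \<Rightarrow> nat" where "weight \<equiv> wt q k"

definition P :: "'k \<Rightarrow> 'k \<Rightarrow> 'k" where
  "P y z = (\<Prod>a\<in>F. y - a * z)"

text \<open>The factor \<open>v 1 ^ (q - 2)\<close> brings the right-hand side to degree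
  \<open>q\<close>. For \<open>i = 2\<close> the coordinate \<open>v (i - 1)\<close> is
  \<open>z\<close>, so the chart \<open>z = 1\<close> shows the bottom equation
  \<open>P(y_1) = x\<close>.\<close>

definition X :: "(nat \<Rightarrow> 'k) set" where
  "X = {v. coordvec n v \<and> v \<noteq> (\<lambda>_. 0) \<and>
     (\<forall>i\<in>{2..n}. P (v i) (v 1) = v 1 ^ (q - 2) * v 0 * v (i - 1))}"

text \<open>Normal forms for the coordinate ring: each equation eliminates the power
  \<open>v i ^ q\<close>, while the exponents of \<open>x\<close> and \<open>z\<close> remain
  free.\<close>

definition Red :: "nat \<Rightarrow> (nat \<Rightarrow> nat) set" where
  "Red m = {\<alpha>\<in>monoms n m. \<forall>i\<in>{2..n}. \<alpha> i < q}"

definition coeffP :: "nat \<Rightarrow> 'k" where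
  "coeffP = (SOME p. p q = 1 \<and> (\<forall>j. p j \<in> F) \<and>
    (\<forall>y z. (\<Prod>a\<in>F. y - a * z) = (\<Sum>j\<le>q. p j * (y ^ j * z ^ (q - j)))))"

lemma coeffP: "coeffP q = 1" "coeffP j \<in> F" "P y z = (\<Sum>j\<le>q. coeffP j * (y ^ j * z ^ (q - j)))"
proof -
  have "coeffP q = 1 \<and> (\<forall>j. coeffP j \<in> F) \<and>
    (\<forall>y z. (\<Prod>a\<in>F. y - a * z) = (\<Sum>j\<le>q. coeffP j * (y ^ j * z ^ (q - j))))"
    unfolding coeffP_def
    using prod_linear_homogeneous_expansion[OF subfield finite_F order_refl] by (rule someI_ex)
  then show "coeffP q = 1" "coeffP j \<in> F" "P y z = (\<Sum>j\<le>q. coeffP j * (y ^ j * z ^ (q - j)))"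
    unfolding P_def by auto
qed

text \<open>Exponents of the term \<open>y_i^j z^(q-j)\<close> of \<open>P\<close>, which is the
  leading one for \<open>j = q\<close>. The companion \<open>top_exp\<close> belongs to the
  right-hand side of the equation, the part of the rewritten \<open>y_i^q\<close> that keeps its
  weight.\<close>

definition low_exp :: "nat \<Rightarrow> nat \<Rightarrow> nat \<Rightarrow> nat" where
  "low_exp i j = (\<lambda>l. single i j l + single 1 (q - j) l)"

definition top_exp :: "nat \<Rightarrow> nat \<Rightarrow> nat" where
  "top_exp i = (\<lambda>l. single 1 (q - 2) l + (single 0 1 l + single (i - 1) 1 l))"

lemma low_exp_monoms: "2 \<le> i \<Longrightarrow> i \<le> n \<Longrightarrow> j \<le> q \<Longrightarrow> low_exp i j \<in> monoms n q"
  using monoms_add[OF monoms_single[of i n j] monoms_single[of 1 n "q - j"]] by (simp add: low_exp_def)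

lemma top_exp_monoms:
  assumes "2 \<le> i" "i \<le> n" shows "top_exp i \<in> monoms n q"
proof -
  have "top_exp i \<in> monoms n ((q - 2) + (1 + 1))" unfolding top_exp_def
    using assms by (intro monoms_add monoms_single) auto
  moreover have "(q - 2) + (1 + 1) = q" using card_F by simp
  ultimately show ?thesis by metis
qed

lemma mon_low_exp:
  assumes "2 \<le> i" "i \<le> n" shows "mon n (low_exp i j) v = v i ^ j * v 1 ^ (q - j)"
  using assms by (simp add: low_exp_def mon_add mon_single)

lemma mon_top_exp:
  assumes "2 \<le> i" "i \<le> n" shows "mon n (top_exp i) v = v 1 ^ (q - 2) * v 0 * v (i - 1)"
  using assms by (simp add: top_exp_def mon_add mon_single)

lemma X_closed: "closed_over n F X"
proof -
  \<comment> \<open>The factor \<open>1\<close> gives the last term the shape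
    \<open>r * mon n \<alpha> v\<close> required by \<open>form_over_mon\<close>.\<close>
  define E where "E = (\<lambda>i (v :: nat \<Rightarrow> 'k). (\<Sum>j\<in>{..q}. coeffP j * mon n (low_exp i j) v) - 1 * mon n (top_exp i) v)"
  have E: "E i v = P (v i) (v 1) - v 1 ^ (q - 2) * v 0 * v (i - 1)" if "i \<in> {2..n}" for i v
    using that by (simp add: E_def coeffP mon_low_exp mon_top_exp)
  have F01: "0 \<in> F" "1 \<in> F" using subfield by (auto simp: subfield_def)
  have "form_over F n q (E i)" if "i \<in> {2..n}" for i
    unfolding E_def using that subfield F01
    by (intro form_over_diff form_over_sum form_over_mon low_exp_monoms top_exp_monoms coeffP) auto
  then have "\<forall>i\<in>{2..n}. \<exists>c. (\<forall>\<alpha>\<in>monoms n q. c \<alpha> \<in> F) \<and> E i = evalf n q c"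
    by (auto simp: form_over_def)
  then obtain c where c: "\<And>i. i \<in> {2..n} \<Longrightarrow> (\<forall>\<alpha>\<in>monoms n q. c i \<alpha> \<in> F) \<and> E i = evalf n q (c i)"
    by metis
  have ev: "evalf n q (c i) v = P (v i) (v 1) - v 1 ^ (q - 2) * v 0 * v (i - 1)" if "i \<in> {2..n}" for i v
    using c[OF that] E[OF that, of v] by metis
  have "X = zset n ((\<lambda>i. (q, c i)) ` {2..n})"
    unfolding X_def zset_def by (auto simp: ev)
  then show ?thesis unfolding closed_over_def using c
    by (intro exI[of _ "(\<lambda>i. (q, c i)) ` {2..n}"]) auto
qed

section \<open>Reduced monomials and the filtration by weight\<close>

lemma finite_Red: "finite (Red m)"
  unfolding Red_def using finite_monoms by auto

text \<open>The weight determines all exponents except that of \<open>z\<close>, and the total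
  degree determines the latter. This makes leading terms unique.\<close>

lemma Red_wt_inject:
  assumes "\<alpha> \<in> Red m" "\<beta> \<in> Red m" "weight \<alpha> = weight \<beta>"
  shows "\<alpha> = \<beta>"
  using assms wt_inject[of q k \<alpha> \<beta>] by (intro monoms_eqI[of _ n m]) (auto simp: Red_def)

text \<open>A filtration of the degree \<open>m\<close> part of the coordinate ring by pole order at
  infinity. Only values on \<open>X\<close> count, so the equations of the curve may be applied
  freely.\<close>

definition low :: "nat \<Rightarrow> nat \<Rightarrow> ((nat \<Rightarrow> 'k) \<Rightarrow> 'k) \<Rightarrow> bool" where
  "low m s f \<longleftrightarrow> (\<exists>c. (\<forall>\<gamma>\<in>Red m. s \<le> weight \<gamma> \<longrightarrow> c \<gamma> = 0) \<and>
     (\<forall>v\<in>X. f v = (\<Sum>\<gamma>\<in>Red m. c \<gamma> * mon n \<gamma> v)))"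

lemma low_cong: "low m s f \<Longrightarrow> (\<And>v. v \<in> X \<Longrightarrow> f v = g v) \<Longrightarrow> low m s g"
  unfolding low_def by auto

lemma low_mono: "low m s f \<Longrightarrow> s \<le> t \<Longrightarrow> low m t f"
  unfolding low_def by (meson order_trans)

lemma low_zero: "low m s (\<lambda>_. 0)"
  unfolding low_def by (rule exI[of _ "\<lambda>_. 0"]) simp

lemma low_add:
  assumes "low m s f" "low m s g" shows "low m s (\<lambda>v. f v + g v)"
proof -
  obtain c d where c: "\<forall>\<gamma>\<in>Red m. s \<le> weight \<gamma> \<longrightarrow> c \<gamma> = 0" "\<forall>v\<in>X. f v = (\<Sum>\<gamma>\<in>Red m. c \<gamma> * mon n \<gamma> v)"
    and d: "\<forall>\<gamma>\<in>Red m. s \<le> weight \<gamma> \<longrightarrow> d \<gamma> = 0" "\<forall>v\<in>X. g v = (\<Sum>\<gamma>\<in>Red m. d \<gamma> * mon n \<gamma> v)"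
    using assms unfolding low_def by blast
  show ?thesis unfolding low_def using c d
    by (intro exI[of _ "\<lambda>\<gamma>. c \<gamma> + d \<gamma>"]) (simp add: sum.distrib distrib_right)
qed

lemma low_scale:
  assumes "low m s f" shows "low m s (\<lambda>v. r * f v)"
proof -
  obtain c where c: "\<forall>\<gamma>\<in>Red m. s \<le> weight \<gamma> \<longrightarrow> c \<gamma> = 0" "\<forall>v\<in>X. f v = (\<Sum>\<gamma>\<in>Red m. c \<gamma> * mon n \<gamma> v)"
    using assms unfolding low_def by blast
  show ?thesis unfolding low_def using c
    by (intro exI[of _ "\<lambda>\<gamma>. r * c \<gamma>"]) (simp add: sum_distrib_left mult.assoc)
qed

lemma low_sum:
  assumes "finite I" "\<And>i. i \<in> I \<Longrightarrow> low m s (f i)" shows "low m s (\<lambda>v. \<Sum>i\<in>I. f i v)"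
  using assms by (induction I rule: finite_induct) (simp_all add: low_zero low_add)

lemma low_mon_Red:
  assumes "\<gamma> \<in> Red m" "weight \<gamma> < s" shows "low m s (mon n \<gamma>)"
proof -
  have "mon n \<gamma> v = (\<Sum>\<delta>\<in>Red m. (if \<delta> = \<gamma> then 1 else 0) * mon n \<delta> v)" for v :: "nat \<Rightarrow> 'k"
  proof -
    have "(\<Sum>\<delta>\<in>Red m. (if \<delta> = \<gamma> then 1 else 0) * mon n \<delta> v) = (\<Sum>\<delta>\<in>Red m. if \<delta> = \<gamma> then mon n \<gamma> v else 0)"
      by (intro sum.cong) auto
    then show ?thesis using assms finite_Red by simp
  qed
  then show ?thesis unfolding low_def using assms
    by (intro exI[of _ "\<lambda>\<delta>. if \<delta> = \<gamma> then 1 else 0"]) auto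
qed

text \<open>Termination measure for the reduction to normal form. The weight cannot serve, since the
  step from \<open>y_i^q\<close> to \<open>top_exp i\<close> preserves it.\<close>

definition ydeg :: "(nat \<Rightarrow> nat) \<Rightarrow> nat" where
  "ydeg \<alpha> = (\<Sum>i=2..n. \<alpha> i)"

lemma ydeg_add: "ydeg (\<lambda>l. \<alpha> l + \<beta> l) = ydeg \<alpha> + ydeg \<beta>"
  by (simp add: ydeg_def sum.distrib)

lemma ydeg_single: "ydeg (single i t) = (if i \<in> {2..n} then t else 0)"
  by (simp add: ydeg_def single_def)

lemma X_power_q:
  assumes "v \<in> X" "2 \<le> i" "i \<le> n"
  shows "v i ^ q = mon n (top_exp i) v - (\<Sum>j<q. coeffP j * mon n (low_exp i j) v)"
proof -
  have "(\<Sum>j\<le>q. coeffP j * (v i ^ j * v 1 ^ (q - j))) = mon n (top_exp i) v"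
    using assms mon_top_exp[OF assms(2,3), of v] coeffP(3)[of "v i" "v 1"] by (simp add: X_def)
  moreover have "(\<Sum>j\<le>q. coeffP j * (v i ^ j * v 1 ^ (q - j)))
      = (\<Sum>j<q. coeffP j * mon n (low_exp i j) v) + v i ^ q"
    using assms by (simp add: lessThan_Suc_atMost[symmetric] coeffP mon_low_exp)
  ultimately show ?thesis by (simp add: algebra_simps)
qed

text \<open>A factor \<open>y_i^q\<close> is rewritten by the equation of the curve. This produces
  one monomial \<open>T\<close> of the same weight, whose normal form is the required
  \<open>\<beta>\<close>, and monomials \<open>L j\<close> of smaller weight, which disappear in the
  remainder. All of them have smaller \<open>ydeg\<close>.\<close>

lemma reduce_mon:
  assumes "\<alpha> \<in> monoms n m"
  shows "\<exists>\<beta>\<in>Red m. weight \<beta> = weight \<alpha> \<and> low m (weight \<alpha>) (\<lambda>v. mon n \<alpha> v - mon n \<beta> v)"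
  using assms
proof (induction "ydeg \<alpha>" arbitrary: \<alpha> rule: less_induct)
  case less
  show ?case
  proof (cases "\<alpha> \<in> Red m")
    case True
    then show ?thesis by (intro bexI[of _ \<alpha>]) (auto simp: low_zero)
  next
    case False
    then obtain i where i: "2 \<le> i" "i \<le> n" "q \<le> \<alpha> i" using less.prems by (auto simp: Red_def not_less)
    define \<alpha>' where "\<alpha>' = \<alpha>(i := \<alpha> i - q)"
    have \<alpha>: "\<alpha> = (\<lambda>l. \<alpha>' l + single i q l)" using i by (auto simp: \<alpha>'_def single_def)
    have "m = sum \<alpha> {..n}" using less.prems by (simp add: monoms_def)
    also have "\<dots> = sum \<alpha>' {..n} + q" using i by (subst \<alpha>) (simp add: sum.distrib single_def)
    finally have m: "m = sum \<alpha>' {..n} + q" .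
    have \<alpha>': "\<alpha>' \<in> monoms n (sum \<alpha>' {..n})" using less.prems i by (auto simp: monoms_def \<alpha>'_def)
    define T where "T = (\<lambda>l. \<alpha>' l + top_exp i l)"
    define L where "L = (\<lambda>j l. \<alpha>' l + low_exp i j l)"
    have Tm: "T \<in> monoms n m" unfolding T_def m using \<alpha>' i by (intro monoms_add top_exp_monoms)
    have Lm: "L j \<in> monoms n m" if "j < q" for j
      unfolding L_def m using \<alpha>' i that by (intro monoms_add low_exp_monoms) auto
    have wT: "weight T = weight \<alpha>"
      using wt_single_recurrence[OF i(1,2), of q] wt_single_scale[of q k i q]
      by (subst \<alpha>) (simp add: T_def top_exp_def wt_add wt_single_1[unfolded One_nat_def])
    have wL: "weight (L j) < weight \<alpha>" if "j < q" for j
      using wt_single_pos[OF i(1,2), of q] that wt_single_scale[of q k i q] wt_single_scale[of q k i j]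
      by (subst \<alpha>) (simp add: L_def low_exp_def wt_add wt_single_1[unfolded One_nat_def])
    \<comment> \<open>At most one factor \<open>y_(i-1)\<close> replaces the
      \<open>q \<ge> 2\<close> factors \<open>y_i\<close>.\<close>
    have dT: "ydeg T < ydeg \<alpha>"
      using i card_F by (subst \<alpha>) (simp add: T_def top_exp_def ydeg_add ydeg_single)
    have dL: "ydeg (L j) < ydeg \<alpha>" if "j < q" for j
      using i that by (subst \<alpha>) (simp add: L_def low_exp_def ydeg_add ydeg_single)
    obtain \<beta> where \<beta>: "\<beta> \<in> Red m" "weight \<beta> = weight \<alpha>" "low m (weight \<alpha>) (\<lambda>v. mon n T v - mon n \<beta> v)"
      using less.hyps[OF dT Tm] wT by auto
    have low_L: "low m (weight \<alpha>) (mon n (L j))" if j: "j < q" for j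
    proof -
      obtain \<delta> where \<delta>: "\<delta> \<in> Red m" "weight \<delta> = weight (L j)"
        "low m (weight (L j)) (\<lambda>v. mon n (L j) v - mon n \<delta> v)"
        using less.hyps[OF dL[OF j] Lm[OF j]] by auto
      have "low m (weight \<alpha>) (\<lambda>v. (mon n (L j) v - mon n \<delta> v) + mon n \<delta> v)"
        using \<delta> wL[OF j] by (intro low_add low_mon_Red low_mono[OF \<delta>(3)]) auto
      then show ?thesis by (rule low_cong) simp
    qed
    have "low m (weight \<alpha>) (\<lambda>v. (mon n T v - mon n \<beta> v) + (-1) * (\<Sum>j<q. coeffP j * mon n (L j) v))"
      using low_L by (intro low_add low_scale low_sum \<beta>) auto
    then have "low m (weight \<alpha>) (\<lambda>v. mon n \<alpha> v - mon n \<beta> v)"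
    proof (rule low_cong)
      fix v assume v: "v \<in> X"
      have "mon n \<alpha> v = mon n \<alpha>' v * v i ^ q" using i by (subst \<alpha>) (simp add: mon_add mon_single)
      also have "\<dots> = mon n T v - (\<Sum>j<q. coeffP j * mon n (L j) v)"
        unfolding X_power_q[OF v i(1,2)] T_def L_def
        by (simp add: mon_add right_diff_distrib sum_distrib_left mult.left_commute)
      finally show "mon n T v - mon n \<beta> v + (-1) * (\<Sum>j<q. coeffP j * mon n (L j) v) = mon n \<alpha> v - mon n \<beta> v"
        by simp
    qed
    then show ?thesis using \<beta> by blast
  qed
qed

lemma low_mon:
  assumes "\<alpha> \<in> monoms n m" "weight \<alpha> < s" shows "low m s (mon n \<alpha>)"
proof -
  obtain \<beta> where \<beta>: "\<beta> \<in> Red m" "weight \<beta> = weight \<alpha>" "low m (weight \<alpha>) (\<lambda>v. mon n \<alpha> v - mon n \<beta> v)"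
    using reduce_mon[OF assms(1)] by blast
  have "low m s (\<lambda>v. (mon n \<alpha> v - mon n \<beta> v) + mon n \<beta> v)"
    using \<beta> assms by (intro low_add low_mon_Red low_mono[OF \<beta>(3)]) auto
  then show ?thesis by (rule low_cong) simp
qed

lemma Red_spanning: "\<exists>c. \<forall>v\<in>X. evalf n m f v = (\<Sum>\<gamma>\<in>Red m. c \<gamma> * mon n \<gamma> v)"
proof -
  \<comment> \<open>The bound exceeds the weight of every monomial of degree \<open>m\<close>, so
    membership in the filtration amounts to being spanned.\<close>
  have "low m (Suc (\<Sum>\<alpha>\<in>monoms n m. weight \<alpha>)) (evalf n m f)"
    unfolding evalf_mon using finite_monoms
    by (intro low_sum low_scale low_mon) (auto simp: less_Suc_eq_le intro!: member_le_sum)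
  then show ?thesis unfolding low_def by blast
qed

text \<open>A weight below \<open>s\<close> and a weight at most \<open>t\<close> add up to less
  than \<open>s + t\<close>. The asymmetric bounds fit the product of a remainder with a form that
  still has its leading term. Products of reduced monomials need not be reduced, hence the appeal to
  \<open>low_mon\<close>.\<close>

lemma low_mult:
  assumes "low a s f" "low b (Suc t) g" shows "low (a + b) (s + t) (\<lambda>v. f v * g v)"
proof -
  obtain c d where c: "\<forall>\<gamma>\<in>Red a. s \<le> weight \<gamma> \<longrightarrow> c \<gamma> = 0" "\<forall>v\<in>X. f v = (\<Sum>\<gamma>\<in>Red a. c \<gamma> * mon n \<gamma> v)"
    and d: "\<forall>\<gamma>\<in>Red b. Suc t \<le> weight \<gamma> \<longrightarrow> d \<gamma> = 0" "\<forall>v\<in>X. g v = (\<Sum>\<gamma>\<in>Red b. d \<gamma> * mon n \<gamma> v)"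
    using assms unfolding low_def by blast
  have "low (a + b) (s + t) (\<lambda>v. (c \<gamma> * d \<delta>) * mon n (\<lambda>l. \<gamma> l + \<delta> l) v)"
    if "\<gamma> \<in> Red a" "\<delta> \<in> Red b" for \<gamma> \<delta>
  proof (cases "weight \<gamma> < s \<and> weight \<delta> \<le> t")
    case True
    then show ?thesis using that
      by (intro low_scale low_mon monoms_add) (auto simp: Red_def wt_add)
  next
    case False
    then have "c \<gamma> * d \<delta> = 0" using c d that by (auto simp: not_less not_le Suc_le_eq)
    then show ?thesis by (simp only: mult_zero_left low_zero)
  qed
  then have "low (a + b) (s + t) (\<lambda>v. \<Sum>\<gamma>\<in>Red a. \<Sum>\<delta>\<in>Red b. (c \<gamma> * d \<delta>) * mon n (\<lambda>l. \<gamma> l + \<delta> l) v)"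
    by (intro low_sum finite_Red) auto
  then show ?thesis
    by (rule low_cong) (simp add: c d sum_product mon_add mult_ac)
qed

section \<open>Linear independence of the reduced monomials\<close>

lemma P_fibre:
  obtains Y where "card Y = q" "\<And>y. y \<in> Y \<Longrightarrow> P y 1 = r"
proof -
  define p where "p = (\<Prod>a\<in>F. [:-a, 1:]) - [:r:]"
  have "degree (\<Prod>a\<in>F. [:-a, 1:]) = q" by (subst degree_prod_eq_sum_degree) auto
  then have "coeff p q = 1"
    using card_F lead_coeff_prod[of "\<lambda>a. [:-a, 1:]" F] by (simp add: p_def coeff_pCons split: nat.split)
  then have "degree p > 0" using card_F le_degree[of p q] by simp
  then obtain y where "poly p y = 0" using alg_closed unfolding alg_closed_field_def by blast
  then have y: "P y 1 = r" by (simp add: p_def poly_prod P_def)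
  \<comment> \<open>Translation by \<open>a\<close> permutes the additive group \<open>F\<close> and
    hence the factors of \<open>P\<close>. The single root found by algebraic closedness therefore
    yields the coset \<open>y + F\<close> of \<open>q\<close> roots.\<close>
  have "P (y + a) 1 = r" if a: "a \<in> F" for a
  proof -
    have "(\<Prod>b\<in>F. y - b) = (\<Prod>b\<in>F. y + a - b)"
    proof (rule prod.reindex_bij_witness[of _ "\<lambda>b. b - a" "\<lambda>b. b + a"])
      show "b - a \<in> F" if "b \<in> F" for b
        using a that subfield unfolding subfield_def by (metis add_uminus_conv_diff)
      show "b + a \<in> F" if "b \<in> F" for b using a that subfield unfolding subfield_def by metis
    qed auto
    then show ?thesis using y by (simp add: P_def)
  qed
  moreover have "card ((+) y ` F) = q" by (simp add: card_image)
  ultimately show thesis using that[of "(+) y ` F"] by auto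
qed

text \<open>The chart \<open>z = 1\<close> up to level \<open>j\<close>. Higher coordinates are
  unrestricted, so a point is lifted to the next level by changing one coordinate.\<close>

definition affine_tower :: "nat \<Rightarrow> (nat \<Rightarrow> 'k) set" where
  "affine_tower j = {v. v 1 = 1 \<and> (\<forall>i\<in>{2..Suc j}. P (v i) 1 = v 0 * v (i - 1))}"

text \<open>Each fibre of one tower level over the previous one has \<open>q\<close> points, while the last
  variable occurs with exponents below \<open>q\<close> only.\<close>
lemma affine_tower_independent:
  assumes "finite \<Gamma>"
    and "\<And>\<gamma> \<delta>. \<gamma> \<in> \<Gamma> \<Longrightarrow> \<delta> \<in> \<Gamma> \<Longrightarrow> (\<And>i. i \<le> Suc j \<Longrightarrow> i \<noteq> 1 \<Longrightarrow> \<gamma> i = \<delta> i) \<Longrightarrow> \<gamma> = \<delta>"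
    and "\<And>\<gamma> i. \<gamma> \<in> \<Gamma> \<Longrightarrow> 2 \<le> i \<Longrightarrow> i \<le> Suc j \<Longrightarrow> \<gamma> i < q"
    and "\<And>v. v \<in> affine_tower j \<Longrightarrow> (\<Sum>\<gamma>\<in>\<Gamma>. c \<gamma> * mon (Suc j) \<gamma> v) = 0"
  shows "\<forall>\<gamma>\<in>\<Gamma>. c \<gamma> = 0"
  using assms
proof (induction j arbitrary: \<Gamma>)
  case 0
  define N where "N = Suc (\<Sum>\<gamma>\<in>\<Gamma>. \<gamma> 0)"
  have N: "(\<lambda>\<gamma>. \<gamma> 0) ` \<Gamma> \<subseteq> {..<N}" unfolding N_def
    using 0(1) by (auto simp: less_Suc_eq_le intro: member_le_sum)
  \<comment> \<open>Grouped by the exponent of \<open>x\<close>, the relation is a polynomial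
    identity in \<open>x\<close>. The assumption on \<open>\<Gamma>\<close> later shows that each
    group has at most one element.\<close>
  have "(\<Sum>e<N. (\<Sum>\<gamma>\<in>{\<gamma>\<in>\<Gamma>. \<gamma> 0 = e}. c \<gamma>) * x ^ e) = 0" for x
  proof -
    have "(\<Sum>e<N. (\<Sum>\<gamma>\<in>{\<gamma>\<in>\<Gamma>. \<gamma> 0 = e}. c \<gamma>) * x ^ e)
        = (\<Sum>e<N. \<Sum>\<gamma>\<in>{\<gamma>\<in>\<Gamma>. \<gamma> 0 = e}. c \<gamma> * x ^ \<gamma> 0)"
      by (simp add: sum_distrib_right)
    also have "\<dots> = (\<Sum>\<gamma>\<in>\<Gamma>. c \<gamma> * x ^ \<gamma> 0)" using 0(1) N by (intro sum.group) auto
    also have "\<dots> = (\<Sum>\<gamma>\<in>\<Gamma>. c \<gamma> * mon (Suc 0) \<gamma> (\<lambda>i. if i = 0 then x else 1))"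
      by (simp add: mon_def)
    also have "\<dots> = 0" by (rule 0(4)) (simp add: affine_tower_def)
    finally show ?thesis .
  qed
  then have z: "\<forall>e<N. (\<Sum>\<gamma>\<in>{\<gamma>\<in>\<Gamma>. \<gamma> 0 = e}. c \<gamma>) = 0"
    using alg_closed_field_infinite[OF alg_closed] by (intro poly_sum_zero_imp_coeffs_zero[of UNIV]) auto
  show ?case
  proof
    fix \<gamma> assume \<gamma>: "\<gamma> \<in> \<Gamma>"
    have "\<delta> = \<gamma>" if "\<delta> \<in> \<Gamma>" "\<delta> 0 = \<gamma> 0" for \<delta>
    proof (rule 0(2)[OF that(1) \<gamma>])
      fix i :: nat assume "i \<le> Suc 0" "i \<noteq> 1"
      then have "i = 0" by simp
      then show "\<delta> i = \<gamma> i" using that(2) by simp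
    qed
    then have "{\<delta>\<in>\<Gamma>. \<delta> 0 = \<gamma> 0} = {\<gamma>}" using \<gamma> by blast
    moreover have "\<gamma> 0 < N" using N \<gamma> by auto
    ultimately show "c \<gamma> = 0" using z by force
  qed
next
  case (Suc j)
  define l where "l = Suc (Suc j)"
  have lt: "(\<lambda>\<gamma>. \<gamma> l) ` \<Gamma> \<subseteq> {..<q}"
  proof (rule image_subsetI)
    show "\<gamma> l \<in> {..<q}" if "\<gamma> \<in> \<Gamma>" for \<gamma>
      using Suc.prems(3)[OF that, of l] unfolding l_def by simp
  qed
  \<comment> \<open>Over a fixed \<open>v\<close> the relation is a polynomial of degree below
    \<open>q\<close> in the new coordinate and vanishes at the \<open>q\<close> points of the fibre.
    Its coefficients are relations on level \<open>j\<close>.\<close>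
  have fibre: "(\<Sum>\<gamma>\<in>{\<gamma>\<in>\<Gamma>. \<gamma> l = e}. c \<gamma> * mon (Suc j) \<gamma> v) = 0" if v: "v \<in> affine_tower j" and e: "e < q" for v e
  proof -
    obtain Y where Y: "card Y = q" "\<And>y. y \<in> Y \<Longrightarrow> P y 1 = v 0 * v (Suc j)"
      using P_fibre[of "v 0 * v (Suc j)"] by blast
    have "(\<Sum>e<q. (\<Sum>\<gamma>\<in>{\<gamma>\<in>\<Gamma>. \<gamma> l = e}. c \<gamma> * mon (Suc j) \<gamma> v) * y ^ e) = 0" if y: "y \<in> Y" for y
    proof -
      have "(\<Sum>e<q. (\<Sum>\<gamma>\<in>{\<gamma>\<in>\<Gamma>. \<gamma> l = e}. c \<gamma> * mon (Suc j) \<gamma> v) * y ^ e)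
        = (\<Sum>e<q. \<Sum>\<gamma>\<in>{\<gamma>\<in>\<Gamma>. \<gamma> l = e}. c \<gamma> * mon (Suc j) \<gamma> v * y ^ \<gamma> l)"
        by (simp add: sum_distrib_right)
      also have "\<dots> = (\<Sum>\<gamma>\<in>\<Gamma>. c \<gamma> * mon (Suc j) \<gamma> v * y ^ \<gamma> l)"
        using Suc.prems(1) lt by (intro sum.group) auto
      also have "\<dots> = (\<Sum>\<gamma>\<in>\<Gamma>. c \<gamma> * mon (Suc (Suc j)) \<gamma> (v(l := y)))"
      proof -
        have "mon (Suc j) \<gamma> (v(l := y)) = mon (Suc j) \<gamma> v" for \<gamma>
          unfolding mon_def by (intro prod.cong) (auto simp: l_def)
        then have "mon (Suc (Suc j)) \<gamma> (v(l := y)) = mon (Suc j) \<gamma> v * y ^ \<gamma> l" for \<gamma>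
          by (simp add: mon_def l_def)
        then show ?thesis by (simp add: mult.assoc)
      qed
      also have "\<dots> = 0"
        using v Y(2)[OF y] by (intro Suc.prems(4)) (auto simp: affine_tower_def l_def le_Suc_eq)
      finally show ?thesis .
    qed
    then have "\<forall>e<q. (\<Sum>\<gamma>\<in>{\<gamma>\<in>\<Gamma>. \<gamma> l = e}. c \<gamma> * mon (Suc j) \<gamma> v) = 0"
      using Y(1) by (intro poly_sum_zero_imp_coeffs_zero[of Y]) auto
    then show ?thesis using e by blast
  qed
  show ?case
  proof
    fix \<gamma> assume \<gamma>: "\<gamma> \<in> \<Gamma>"
    define \<Delta> where "\<Delta> = {\<delta>\<in>\<Gamma>. \<delta> l = \<gamma> l}"
    have "\<forall>\<delta>\<in>\<Delta>. c \<delta> = 0"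
    proof (rule Suc.IH)
      show "finite \<Delta>" using Suc.prems(1) by (simp add: \<Delta>_def)
      show "\<delta> = \<epsilon>" if "\<delta> \<in> \<Delta>" "\<epsilon> \<in> \<Delta>" "\<And>i. i \<le> Suc j \<Longrightarrow> i \<noteq> 1 \<Longrightarrow> \<delta> i = \<epsilon> i" for \<delta> \<epsilon>
        using that by (intro Suc.prems(2)) (auto simp: \<Delta>_def l_def le_Suc_eq)
      show "\<delta> i < q" if "\<delta> \<in> \<Delta>" "2 \<le> i" "i \<le> Suc j" for \<delta> i
        using that Suc.prems(3)[of \<delta> i] by (auto simp: \<Delta>_def)
      show "(\<Sum>\<delta>\<in>\<Delta>. c \<delta> * mon (Suc j) \<delta> v) = 0" if "v \<in> affine_tower j" for v
        using fibre[OF that, of "\<gamma> l"] lt \<gamma> unfolding \<Delta>_def by auto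
    qed
    then show "c \<gamma> = 0" using \<gamma> by (simp add: \<Delta>_def)
  qed
qed

lemma Red_independent:
  assumes "\<forall>v\<in>X. (\<Sum>\<gamma>\<in>Red m. c \<gamma> * mon n \<gamma> v) = 0"
  shows "\<forall>\<gamma>\<in>Red m. c \<gamma> = 0"
proof (rule affine_tower_independent[where j = k])
  show "finite (Red m)" by (rule finite_Red)
  show "\<gamma> = \<delta>" if "\<gamma> \<in> Red m" "\<delta> \<in> Red m" "\<And>i. i \<le> Suc k \<Longrightarrow> i \<noteq> 1 \<Longrightarrow> \<gamma> i = \<delta> i" for \<gamma> \<delta>
    using that by (intro monoms_eqI[of _ n m]) (auto simp: Red_def)
  show "\<gamma> i < q" if "\<gamma> \<in> Red m" "2 \<le> i" "i \<le> Suc k" for \<gamma> i using that by (simp add: Red_def)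
  show "(\<Sum>\<gamma>\<in>Red m. c \<gamma> * mon (Suc k) \<gamma> v) = 0" if v: "v \<in> affine_tower k" for v
  proof -
    \<comment> \<open>Points of \<open>X\<close> must vanish beyond coordinate \<open>n\<close>,
      which \<open>affine_tower\<close> does not demand.\<close>
    define w where "w = (\<lambda>i. if i \<le> n then v i else 0)"
    have "mon n \<gamma> w = mon n \<gamma> v" for \<gamma> unfolding mon_def by (intro prod.cong) (auto simp: w_def)
    moreover have "w \<in> X"
    proof -
      have "w 1 = 1" using v by (simp add: w_def affine_tower_def)
      then have "w \<noteq> (\<lambda>_. 0)" by (metis zero_neq_one)
      moreover have "coordvec n w" by (simp add: coordvec_def w_def)
      moreover have "P (w i) (w 1) = w 1 ^ (q - 2) * w 0 * w (i - 1)" if "i \<in> {2..n}" for i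
        using \<open>w 1 = 1\<close> v that le_trans[OF diff_le_self, of i n 1] by (simp add: w_def affine_tower_def)
      ultimately show ?thesis by (simp add: X_def)
    qed
    ultimately show ?thesis using assms by force
  qed
qed

section \<open>The Hilbert function and the irreducibility of the curve\<close>

lemma hilb_X: "hilb n X m = card (Red m)"
  using Red_spanning Red_independent by (intro hilb_eq_card) (auto simp: Red_def)

text \<open>Among the reduced monomials with nonzero coefficient, one has the largest weight.
  Distinct reduced monomials have distinct weights, so all the others lie strictly lower.\<close>

lemma leading_term:
  assumes "v \<in> X" "evalf n m f v \<noteq> 0"
  obtains \<gamma> r where "\<gamma> \<in> Red m" "r \<noteq> 0" "low m (weight \<gamma>) (\<lambda>v. evalf n m f v - r * mon n \<gamma> v)"
proof -
  obtain c where c: "\<forall>v\<in>X. evalf n m f v = (\<Sum>\<gamma>\<in>Red m. c \<gamma> * mon n \<gamma> v)" using Red_spanning by blast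
  define S where "S = {\<gamma>\<in>Red m. c \<gamma> \<noteq> 0}"
  have "S \<noteq> {}"
  proof
    assume "S = {}"
    then have "evalf n m f v = 0" using c assms(1) by (auto simp: S_def)
    then show False using assms(2) by simp
  qed
  moreover have "finite S" using finite_Red by (simp add: S_def)
  ultimately have "Max (weight ` S) \<in> weight ` S" by (intro Max_in) auto
  then obtain \<gamma> where \<gamma>: "\<gamma> \<in> S" "weight \<gamma> = Max (weight ` S)" by auto
  have "c \<delta> = 0" if "\<delta> \<in> Red m" "weight \<gamma> \<le> weight \<delta>" "\<delta> \<noteq> \<gamma>" for \<delta>
  proof (rule ccontr)
    assume "c \<delta> \<noteq> 0"
    then have "weight \<delta> \<le> weight \<gamma>" using that \<gamma> \<open>finite S\<close> by (auto simp: S_def)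
    then show False using that \<gamma> Red_wt_inject[of \<delta> m \<gamma>] by (auto simp: S_def)
  qed
  moreover have "evalf n m f v - c \<gamma> * mon n \<gamma> v = (\<Sum>\<delta>\<in>Red m. (if \<delta> = \<gamma> then 0 else c \<delta>) * mon n \<delta> v)"
    if "v \<in> X" for v
  proof -
    have "(\<Sum>\<delta>\<in>Red m. (if \<delta> = \<gamma> then 0 else c \<delta>) * mon n \<delta> v) = (\<Sum>\<delta>\<in>Red m - {\<gamma>}. c \<delta> * mon n \<delta> v)"
      using finite_Red by (intro sum.mono_neutral_cong_right) auto
    moreover have "\<gamma> \<in> Red m" using \<gamma> by (simp add: S_def)
    ultimately show ?thesis using c that finite_Red sum.remove[of "Red m" \<gamma> "\<lambda>\<delta>. c \<delta> * mon n \<delta> v"] by simp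
  qed
  ultimately have "low m (weight \<gamma>) (\<lambda>v. evalf n m f v - c \<gamma> * mon n \<gamma> v)"
    unfolding low_def by (intro exI[of _ "\<lambda>\<delta>. if \<delta> = \<gamma> then 0 else c \<delta>"]) auto
  then show thesis using that \<gamma> by (auto simp: S_def)
qed

text \<open>The product of the leading terms reduces to a nonzero multiple of a single reduced
  monomial \<open>\<beta>\<close>, whose weight is the sum of the two weights. Everything else has
  smaller weight, so if the product vanished on \<open>X\<close>, the monomial
  \<open>\<beta>\<close> would depend linearly on other reduced monomials.\<close>

lemma forms_on_X_no_zero_divisors:
  assumes "v \<in> X" "evalf n a f v \<noteq> 0" "w \<in> X" "evalf n b g w \<noteq> 0"
  shows "\<exists>u\<in>X. evalf n a f u * evalf n b g u \<noteq> 0"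
proof (rule ccontr)
  assume "\<not> ?thesis"
  then have zero: "evalf n a f u * evalf n b g u = 0" if "u \<in> X" for u using that by blast
  obtain \<gamma> r where \<gamma>: "\<gamma> \<in> Red a" "r \<noteq> 0" "low a (weight \<gamma>) (\<lambda>v. evalf n a f v - r * mon n \<gamma> v)"
    using leading_term[OF assms(1,2)] .
  obtain \<delta> s where \<delta>: "\<delta> \<in> Red b" "s \<noteq> 0" "low b (weight \<delta>) (\<lambda>v. evalf n b g v - s * mon n \<delta> v)"
    using leading_term[OF assms(3,4)] .
  let ?M = "weight \<gamma> + weight \<delta>"
  have "(\<lambda>l. \<gamma> l + \<delta> l) \<in> monoms n (a + b)" using \<gamma> \<delta> by (intro monoms_add) (auto simp: Red_def)
  then obtain \<beta> where \<beta>: "\<beta> \<in> Red (a + b)" "weight \<beta> = ?M"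
    "low (a + b) ?M (\<lambda>v. mon n (\<lambda>l. \<gamma> l + \<delta> l) v - mon n \<beta> v)"
    using reduce_mon[of "\<lambda>l. \<gamma> l + \<delta> l" "a + b"] unfolding wt_add by blast
  have lf: "low a (Suc (weight \<gamma>)) (mon n \<gamma>)" using \<gamma> by (intro low_mon_Red) auto
  have "low b (Suc (weight \<delta>)) (\<lambda>v. (evalf n b g v - s * mon n \<delta> v) + s * mon n \<delta> v)"
    using \<delta> by (intro low_add low_scale low_mon_Red low_mono[OF \<delta>(3)]) auto
  then have lg: "low b (Suc (weight \<delta>)) (evalf n b g)" by (rule low_cong) simp
  have "low (a + b) ?M (\<lambda>v. (evalf n a f v - r * mon n \<gamma> v) * evalf n b g v)"
    using low_mult[OF \<gamma>(3) lg] .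
  moreover have "low (a + b) ?M (\<lambda>v. (evalf n b g v - s * mon n \<delta> v) * mon n \<gamma> v)"
    using low_mult[OF \<delta>(3) lf] by (simp add: add.commute)
  \<comment> \<open>The sum telescopes to the product of the two forms minus
    \<open>r * s * mon n \<beta> v\<close>, and that product is zero on \<open>X\<close>.\<close>
  ultimately have "low (a + b) ?M (\<lambda>v. (evalf n a f v - r * mon n \<gamma> v) * evalf n b g v
      + (r * ((evalf n b g v - s * mon n \<delta> v) * mon n \<gamma> v)
      + (r * s) * (mon n (\<lambda>l. \<gamma> l + \<delta> l) v - mon n \<beta> v)))"
    using \<beta>(3) by (intro low_add low_scale)
  then have "low (a + b) ?M (\<lambda>v. - (r * s * mon n \<beta> v))"
    by (rule low_cong) (use zero in \<open>simp add: mon_add algebra_simps\<close>)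
  then obtain c where c: "\<forall>\<gamma>\<in>Red (a + b). ?M \<le> weight \<gamma> \<longrightarrow> c \<gamma> = 0"
    "\<forall>v\<in>X. - (r * s * mon n \<beta> v) = (\<Sum>\<gamma>\<in>Red (a + b). c \<gamma> * mon n \<gamma> v)" unfolding low_def by blast
  have "\<forall>\<epsilon>\<in>Red (a + b). c \<epsilon> + (if \<epsilon> = \<beta> then r * s else 0) = 0"
  proof (rule Red_independent, rule ballI)
    fix v assume v: "v \<in> X"
    have "(\<Sum>\<epsilon>\<in>Red (a + b). (if \<epsilon> = \<beta> then r * s else 0) * mon n \<epsilon> v)
       = (\<Sum>\<epsilon>\<in>Red (a + b). if \<epsilon> = \<beta> then r * s * mon n \<beta> v else 0)"
      by (intro sum.cong) auto
    then show "(\<Sum>\<epsilon>\<in>Red (a + b). (c \<epsilon> + (if \<epsilon> = \<beta> then r * s else 0)) * mon n \<epsilon> v) = 0"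
      using c(2) v \<beta>(1) finite_Red by (simp add: distrib_right sum.distrib) (metis add.left_inverse)
  qed
  then have "c \<beta> + r * s = 0" using \<beta>(1) by auto
  then show False using c(1) \<beta> \<gamma>(2) \<delta>(2) by auto
qed

text \<open>If \<open>X\<close> lies in neither \<open>A\<close> nor \<open>B\<close>, each of these
  sets has a defining form that is nonzero somewhere on \<open>X\<close>. The absence of zero
  divisors gives one point of \<open>X\<close> at which both forms are nonzero, and this point lies
  outside the union.\<close>

lemma X_irreducible: "irreducible_closed n X"
  unfolding irreducible_closed_def
proof (intro conjI allI impI)
  \<comment> \<open>Only \<open>x\<close> is nonzero at this point at infinity. Both sides of each
    equation vanish there, on the right because \<open>v (i - 1) = 0\<close>.\<close>
  have "(\<lambda>i. if i = 0 then 1 else 0) \<in> X"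
    using card_F finite_F by (auto simp: X_def coordvec_def P_def fun_eq_iff zero_power)
  then show "X \<noteq> {}" by blast
next
  fix A B assume A: "closed_over n UNIV A" and B: "closed_over n UNIV B" and sub: "X \<subseteq> A \<union> B"
  obtain S where S: "A = zset n S" using A unfolding closed_over_def by blast
  obtain T where T: "B = zset n T" using B unfolding closed_over_def by blast
  show "X \<subseteq> A \<or> X \<subseteq> B"
  proof (rule ccontr)
    assume "\<not> ?thesis"
    then obtain v w where vw: "v \<in> X" "v \<notin> A" "w \<in> X" "w \<notin> B" by blast
    obtain a f where f: "(a, f) \<in> S" "evalf n a f v \<noteq> 0" using vw by (auto simp: S zset_def X_def)
    obtain b g where g: "(b, g) \<in> T" "evalf n b g w \<noteq> 0" using vw by (auto simp: T zset_def X_def)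
    obtain u where u: "u \<in> X" "evalf n a f u * evalf n b g u \<noteq> 0"
      using forms_on_X_no_zero_divisors[OF vw(1) f(2) vw(3) g(2)] by blast
    then have "u \<in> A \<or> u \<in> B" using sub by blast
    then show False using u f(1) g(1) by (auto simp: S T zset_def)
  qed
qed

section \<open>The degree of the curve\<close>

lemma card_box: "card ({2..n} \<rightarrow>\<^sub>E {..<q}) = q ^ k"
  by (simp add: card_PiE)

lemma card_Red_upper: "card (Red m) \<le> (m + 1) * q ^ k"
proof -
  have "card (Red m) \<le> card ({..m} \<times> ({2..n} \<rightarrow>\<^sub>E {..<q}))"
  proof (rule card_inj_on_le)
    show "inj_on (\<lambda>\<alpha>. (\<alpha> 0, restrict \<alpha> {2..n})) (Red m)"
    proof (rule inj_onI)
      fix \<alpha> \<beta> assume ab: "\<alpha> \<in> Red m" "\<beta> \<in> Red m" "(\<alpha> 0, restrict \<alpha> {2..n}) = (\<beta> 0, restrict \<beta> {2..n})"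
      have "\<alpha> i = \<beta> i" if "i \<le> n" "i \<noteq> 1" for i
      proof (cases "i = 0")
        case False
        then have "i \<in> {2..n}" using that by auto
        then show ?thesis using ab(3) by (metis Pair_inject restrict_apply')
      qed (use ab in simp)
      then show "\<alpha> = \<beta>" using ab by (intro monoms_eqI[of _ n m]) (auto simp: Red_def)
    qed
    show "(\<lambda>\<alpha>. (\<alpha> 0, restrict \<alpha> {2..n})) ` Red m \<subseteq> {..m} \<times> ({2..n} \<rightarrow>\<^sub>E {..<q})"
    proof
      fix x assume "x \<in> (\<lambda>\<alpha>. (\<alpha> 0, restrict \<alpha> {2..n})) ` Red m"
      then obtain \<alpha> where \<alpha>: "\<alpha> \<in> Red m" "x = (\<alpha> 0, restrict \<alpha> {2..n})" by blast
      have "\<alpha> 0 \<le> m" using \<alpha>(1) member_le_sum[of 0 "{..n}" \<alpha>] by (auto simp: Red_def monoms_def)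
      then show "x \<in> {..m} \<times> ({2..n} \<rightarrow>\<^sub>E {..<q})" using \<alpha> by (auto simp: Red_def)
    qed
    show "finite ({..m} \<times> ({2..n} \<rightarrow>\<^sub>E {..<q}))" by (intro finite_SigmaI finite_PiE) auto
  qed
  then show ?thesis by (simp add: card_cartesian_product card_box)
qed

text \<open>The \<open>y\<close> exponents sum to at most \<open>k * q\<close>. With an exponent of
  \<open>x\<close> below \<open>m - k * q\<close> there is always room for \<open>z\<close> to fill
  up the degree, so the subtraction in \<open>h\<close> is not truncated.\<close>

lemma card_Red_lower: "(m - k * q) * q ^ k \<le> card (Red m)"
proof -
  define h where "h = (\<lambda>(a, e). (\<lambda>i. if i = 0 then a else if i = 1 then m - a - (\<Sum>i=2..n. e i)
     else if i \<le> n then e i else (0::nat)))"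
  have "card ({..<m - k * q} \<times> ({2..n} \<rightarrow>\<^sub>E {..<q})) \<le> card (Red m)"
  proof (rule card_inj_on_le[of h])
    show "inj_on h ({..<m - k * q} \<times> ({2..n} \<rightarrow>\<^sub>E {..<q}))"
    proof (rule inj_onI, clarsimp)
      fix a e a' e' assume e: "e \<in> {2..n} \<rightarrow>\<^sub>E {..<q}" "e' \<in> {2..n} \<rightarrow>\<^sub>E {..<q}" and h: "h (a, e) = h (a', e')"
      have "a = a'" using fun_cong[OF h, of 0] by (simp add: h_def)
      moreover have "e = e'"
      proof (rule PiE_ext[OF e])
        fix i assume "i \<in> {2..n}"
        then show "e i = e' i" using fun_cong[OF h, of i] by (simp add: h_def)
      qed
      ultimately show "a = a' \<and> e = e'" by simp
    qed
    show "h ` ({..<m - k * q} \<times> ({2..n} \<rightarrow>\<^sub>E {..<q})) \<subseteq> Red m"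
    proof clarsimp
      fix a e assume a: "a < m - k * q" and e: "e \<in> {2..n} \<rightarrow>\<^sub>E {..<q}"
      have lt: "e i < q" if "i \<in> {2..n}" for i using e that by auto
      have "(\<Sum>i=2..n. e i) \<le> (\<Sum>i=2..n. q)" using lt by (intro sum_mono) (auto intro: less_imp_le)
      then have le: "a + (\<Sum>i=2..n. e i) \<le> m" using a by simp
      have set: "{..n} = insert 0 (insert 1 {2..n})" by auto
      have "(\<Sum>i\<in>{2..n}. h (a, e) i) = (\<Sum>i=2..n. e i)" by (intro sum.cong) (auto simp: h_def)
      then have "(\<Sum>i\<le>n. h (a, e) i) = m" unfolding set using le by (simp add: h_def)
      then show "h (a, e) \<in> Red m" using lt by (auto simp: Red_def monoms_def h_def)
    qed
  qed (rule finite_Red)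
  then show ?thesis by (simp add: card_cartesian_product card_box)
qed

lemma hilb_asymptotics: "(\<lambda>m. real (hilb n X m) / real m) \<longlonglongrightarrow> real (q ^ k)"
proof (rule tendsto_sandwich)
  let ?d = "real (q ^ k)"
  show "\<forall>\<^sub>F m in sequentially. ?d - real (k * q) * ?d / real m \<le> real (hilb n X m) / real m"
    using eventually_gt_at_top[of 0]
  proof eventually_elim
    case (elim m)
    \<comment> \<open>Truncated subtraction of naturals can only enlarge the right-hand
      side.\<close>
    have "real m - real (k * q) \<le> real (m - k * q)" by (cases "k * q \<le> m") (simp_all del: of_nat_mult)
    then have "(real m - real (k * q)) * ?d \<le> real (m - k * q) * ?d" by (intro mult_right_mono) auto
    also have "\<dots> \<le> real (card (Red m))" using card_Red_lower[of m] by (metis of_nat_le_iff of_nat_mult)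
    finally have "(real m - real (k * q)) * ?d / real m \<le> real (card (Red m)) / real m"
      by (rule divide_right_mono) simp
    then show ?case using elim unfolding hilb_X by (simp add: left_diff_distrib diff_divide_distrib)
  qed
  show "\<forall>\<^sub>F m in sequentially. real (hilb n X m) / real m \<le> ?d + ?d / real m"
    using eventually_gt_at_top[of 0]
  proof eventually_elim
    case (elim m)
    have "real (card (Red m)) \<le> (real m + 1) * ?d"
      using card_Red_upper[of m] by (metis of_nat_le_iff of_nat_mult of_nat_add of_nat_1)
    then have "real (card (Red m)) / real m \<le> (real m + 1) * ?d / real m"
      by (rule divide_right_mono) simp
    then show ?case using elim unfolding hilb_X by (simp add: distrib_right add_divide_distrib)
  qed
  show "(\<lambda>m. ?d - real (k * q) * ?d / real m) \<longlonglongrightarrow> ?d"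
    using tendsto_diff[OF tendsto_const lim_const_over_n] by force
  show "(\<lambda>m. ?d + ?d / real m) \<longlonglongrightarrow> ?d"
    using tendsto_add[OF tendsto_const lim_const_over_n] by force
qed

lemma curve_X: "curve_of_degree F n X (q ^ k)"
  using X_closed X_irreducible hilb_asymptotics card_F by (auto simp: curve_of_degree_def)

section \<open>Rational points\<close>

lemma finite_rat_points: "finite (rat_points F X)"
proof (rule finite_subset)
  show "rat_points F X \<subseteq> pclass ` {v. \<forall>i. (i \<in> {..n} \<longrightarrow> v i \<in> F) \<and> (i \<notin> {..n} \<longrightarrow> v i = 0)}"
    unfolding rat_points_def X_def coordvec_def by auto
  show "finite (pclass ` {v. \<forall>i. (i \<in> {..n} \<longrightarrow> v i \<in> F) \<and> (i \<notin> {..n} \<longrightarrow> v i = 0)})"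
    using finite_F by (intro finite_imageI finite_set_of_finite_funs) auto
qed

text \<open>Over \<open>x = 0\<close> and \<open>z = 1\<close> every equation becomes
  \<open>P(y_i, 1) = 0\<close>, which holds for each element of \<open>F\<close>. The
  \<open>y\<close> coordinates can thus be chosen in \<open>F\<close> independently.\<close>

lemma card_rat_points: "q ^ k \<le> card (rat_points F X)"
proof -
  define h where "h = (\<lambda>e i. if i = 1 then 1 else if i \<in> {2..n} then e i else (0::'k))"
  have F01: "0 \<in> F" "1 \<in> F" using subfield by (auto simp: subfield_def)
  have "card ({2..n} \<rightarrow>\<^sub>E F) \<le> card (rat_points F X)"
  proof (rule card_inj_on_le[of "\<lambda>e. pclass (h e)"])
    show "inj_on (\<lambda>e. pclass (h e)) ({2..n} \<rightarrow>\<^sub>E F)"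
    proof (rule inj_onI)
      fix e e' assume e: "e \<in> {2..n} \<rightarrow>\<^sub>E F" "e' \<in> {2..n} \<rightarrow>\<^sub>E F" and eq: "pclass (h e) = pclass (h e')"
      have "h e \<in> pclass (h e)" unfolding pclass_def by (simp add: exI[of _ 1])
      then obtain c where c: "h e = (\<lambda>i. c * h e' i)" unfolding eq by (auto simp: pclass_def)
      \<comment> \<open>Both representatives have \<open>z = 1\<close>, which fixes the
        scalar.\<close>
      have "c = 1" using fun_cong[OF c, of 1] by (simp add: h_def)
      then have eqh: "h e i = h e' i" for i using fun_cong[OF c, of i] by simp
      show "e = e'"
      proof (rule PiE_ext[OF e])
        fix i assume "i \<in> {2..n}"
        then show "e i = e' i" using eqh[of i] by (simp add: h_def)
      qed
    qed
    show "(\<lambda>e. pclass (h e)) ` ({2..n} \<rightarrow>\<^sub>E F) \<subseteq> rat_points F X"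
    proof
      fix x assume "x \<in> (\<lambda>e. pclass (h e)) ` ({2..n} \<rightarrow>\<^sub>E F)"
      then obtain e where e: "e \<in> {2..n} \<rightarrow>\<^sub>E F" "x = pclass (h e)" by blast
      have eF: "e i \<in> F" if "i \<in> {2..n}" for i using e that by auto
      have "h e 1 \<noteq> 0" by (simp add: h_def)
      then have "h e \<noteq> (\<lambda>_. 0)" by metis
      moreover have "P (h e i) (h e 1) = 0" if "i \<in> {2..n}" for i
        using eF[OF that] that finite_F by (auto simp: P_def h_def)
      ultimately have "h e \<in> X" by (auto simp: X_def coordvec_def h_def)
      moreover have "h e i \<in> F" for i using eF F01 by (simp add: h_def)
      ultimately show "x \<in> rat_points F X" using e(2) unfolding rat_points_def by blast
    qed
  qed (rule finite_rat_points)
  then show ?thesis by (simp add: card_PiE)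
qed

section \<open>Passage to Homma's constant\<close>

lemma Mq_lower: "ereal (real (q ^ k)) \<le> Mq F (q ^ k)"
proof -
  have "ereal (real (q ^ k)) \<le> ereal (real (card (rat_points F X)))" using card_rat_points by simp
  also have "\<dots> \<le> Mq F (q ^ k)" unfolding Mq_def using curve_X by (intro Sup_upper) blast
  finally show ?thesis .
qed

end

theorem theorem1p1:
  fixes F :: "'k::field set"
  assumes "alg_closed_field TYPE('k)"
    and "subfield F" and "finite F" and "card F > 2"
  shows "homma_D F \<ge> 1"
proof -
  have tower: "artin_schreier_tower F" using assms by unfold_locales auto
  let ?f = "\<lambda>d. Mq F d / ereal (real d)"
  \<comment> \<open>The curves supply degrees \<open>q^k\<close> only. This suffices because these
    degrees increase strictly with \<open>k\<close>, and an upper limit along a subsequence bounds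
    the full one from below.\<close>
  have "1 \<le> (?f \<circ> (\<lambda>k. card F ^ k)) k" for k
  proof -
    have pos: "0 < real (card F ^ k)" using assms by simp
    have "1 = ereal (real (card F ^ k)) / ereal (real (card F ^ k))" using pos by (simp add: one_ereal_def)
    also have "\<dots> \<le> ?f (card F ^ k)"
      using artin_schreier_tower.Mq_lower[OF tower, of k] pos by (intro ereal_divide_right_mono) auto
    finally show ?thesis by simp
  qed
  then have "1 \<le> limsup (?f \<circ> (\<lambda>k. card F ^ k))"
    by (intro le_Limsup always_eventually) auto
  also have "\<dots> \<le> limsup ?f"
    using assms(4) by (intro limsup_subseq_mono strict_monoI power_strict_increasing) auto
  finally show ?thesis unfolding homma_D_def .
qed

end
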